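(* Let $G$ be a finite connected cubic (3-regular) simple graph of girth $5$ such that its adjacency matrix has no eigenvalues in the open interval $(-2,0)$. Then $G$ is isomorphic either to the Petersen graph or to the dodecahedron.
   Context: Eigenvalues of a graph are those of its adjacency matrix. The girth of a graph is the length of its shortest cycle. *)

theory Defs
  imports
    Complex_Main
    "HOL-Library.Extended_Nat"
    "HOL-Analysis.Product_Vector"
    "Graph_Theory.Graph_Theory"
    "Jordan_Normal_Form.Char_Poly"
begin

text \<open>
  A symmetric digraph contains the closed walk \<open>u, v, u\<close> for every edge, and this counts as a
  cycle of length 2 in \<^const>\<open>pre_digraph.cycle\<close>. Cycles of a simple graph are those of length
  at least 3. The girth of a forest is \<open>\<infinity>\<close>.
\<close>

definition girth :: "'a pair_pre_digraph \<Rightarrow> enat" where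
  "girth G = (INF p \<in> {p. pre_digraph.cycle (with_proj G) p \<and> 3 \<le> length p}. enat (length p))"

definition adjacency_matrix :: "'a pair_pre_digraph \<Rightarrow> 'a list \<Rightarrow> real mat" where
  "adjacency_matrix G vs =
     mat (length vs) (length vs) (\<lambda>(i, j). if (vs ! i, vs ! j) \<in> parcs G then 1 else 0)"

text \<open>The Petersen graph as the Kneser graph on the 2-subsets of a 5-set.\<close>

definition petersen_graph :: "nat set pair_pre_digraph" where
  "petersen_graph =
     \<lparr> pverts = {S. S \<subseteq> {..<5} \<and> card S = 2},
       parcs = {(S, T). S \<subseteq> {..<5} \<and> card S = 2 \<and> T \<subseteq> {..<5} \<and> card T = 2 \<and> S \<inter> T = {}} \<rparr>"

text \<open>
  The graph of the dodecahedron as the generalized Petersen graph with parameters \<open>(10, 2)\<close>.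
  Lemma \<open>dodecahedral_graph_skeleton\<close> below identifies it with the vertices and edges of
  the regular dodecahedron in Euclidean space.
\<close>

definition generalized_petersen :: "nat \<Rightarrow> nat \<Rightarrow> (bool \<times> nat) pair_pre_digraph" where
  "generalized_petersen n k =
     (let E = (\<Union>i<n. {((False, i), (False, (i + 1) mod n)),
                       ((False, i), (True, i)),
                       ((True, i), (True, (i + k) mod n))})
      in \<lparr> pverts = UNIV \<times> {..<n}, parcs = E \<union> E\<inverse> \<rparr>)"

definition dodecahedral_graph :: "(bool \<times> nat) pair_pre_digraph" where
  "dodecahedral_graph = generalized_petersen 10 2"

text \<open>
  In the following list a pair \<open>(a, b)\<close> of integers stands for the coordinate \<open>a + b \<phi>\<close>; the two
  halves list the points assigned to the outer and to the inner vertices.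
\<close>

definition dodecahedron_points :: "((int \<times> int) \<times> (int \<times> int) \<times> (int \<times> int)) list" where
  "dodecahedron_points =
    (let o0 = (0, 0); o1 = (1, 0); n1 = (-1, 0); p = (0, 1); np = (0, -1); q = (-1, 1); nq = (1, -1)
     in [(o1, o1, o1), (q, p, o0), (nq, p, o0), (n1, o1, n1), (np, o0, nq),
         (n1, n1, n1), (nq, np, o0), (q, np, o0), (o1, n1, o1), (p, o0, q),
         (o0, q, p), (o1, o1, n1), (n1, o1, o1), (o0, q, np), (np, o0, q),
         (o0, nq, np), (n1, n1, o1), (o1, n1, n1), (o0, nq, p), (p, o0, nq)])"

definition golden_square :: "int \<times> int \<Rightarrow> int \<times> int \<Rightarrow> int \<times> int" where
  "golden_square x y =
    (let a = fst x - fst y; b = snd x - snd y in (a * a + b * b, 2 * a * b + b * b))"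

definition golden_dist2 ::
  "(int \<times> int) \<times> (int \<times> int) \<times> (int \<times> int) \<Rightarrow> (int \<times> int) \<times> (int \<times> int) \<times> (int \<times> int) \<Rightarrow> int \<times> int" where
  "golden_dist2 u v = (case (u, v) of ((x, y, z), (x', y', z')) \<Rightarrow>
     (fst (golden_square x x') + fst (golden_square y y') + fst (golden_square z z'),
      snd (golden_square x x') + snd (golden_square y y') + snd (golden_square z z')))"

definition dodecahedral_adj :: "bool \<times> nat \<Rightarrow> bool \<times> nat \<Rightarrow> bool" where
  "dodecahedral_adj u v = (case (u, v) of ((b, i), (c, j)) \<Rightarrow>
     if b = c then (let k = if b then 2 else 1 in j = (i + k) mod 10 \<or> i = (j + k) mod 10)
     else i = j)"

lemma dodecahedron_points_distinct: "distinct dodecahedron_points"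
  by code_simp

lemma dodecahedron_points_adj:
  "\<forall>b \<in> set [False, True]. \<forall>c \<in> set [False, True]. \<forall>i \<in> set [0..<10]. \<forall>j \<in> set [0..<10].
     dodecahedral_adj (b, i) (c, j) \<longleftrightarrow>
       golden_dist2 (dodecahedron_points ! (if b then 10 + i else i))
         (dodecahedron_points ! (if c then 10 + j else j)) = (8, -4)"
  by code_simp

lemma golden_norm_eq_0:
  fixes a b :: int
  assumes "a * a + a * b = b * b"
  shows "a = 0 \<and> b = 0"
  using assms
proof (induction "nat (\<bar>a\<bar> + \<bar>b\<bar>)" arbitrary: a b rule: less_induct)
  case less
  have "even (a * a + a * b) \<longleftrightarrow> even (b * b)" using less.prems by simp
  then have "even a" "even b" by auto
  then obtain c d where cd: "a = 2 * c" "b = 2 * d" by (auto elim!: evenE)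
  have "c * c + c * d = d * d" using less.prems by (simp add: cd algebra_simps)
  show ?case
  proof (rule ccontr)
    assume "\<not> ?case"
    then have "nat (\<bar>c\<bar> + \<bar>d\<bar>) < nat (\<bar>a\<bar> + \<bar>b\<bar>)" by (auto simp: cd)
    from less.hyps[OF this] \<open>c * c + c * d = d * d\<close> \<open>\<not> ?case\<close> show False by (simp add: cd)
  qed
qed

text \<open>
  The points below are the standard coordinates of the 20 vertices of the regular
  dodecahedron with edge length \<open>2 / \<phi>\<close>; its edges join the pairs of vertices at that distance.
\<close>

lemma dodecahedral_graph_skeleton:
  fixes p q :: real
  assumes p_def: "p = (1 + sqrt 5) / 2" and q_def: "q = 1 / p"
  shows "\<exists>f :: bool \<times> nat \<Rightarrow> real \<times> real \<times> real.
    bij_betw f (pverts dodecahedral_graph)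
      ({-1, 1} \<times> {-1, 1} \<times> {-1, 1} \<union> {0} \<times> {-q, q} \<times> {-p, p} \<union>
       {-q, q} \<times> {-p, p} \<times> {0} \<union> {-p, p} \<times> {0} \<times> {-q, q}) \<and>
    (\<forall>u \<in> pverts dodecahedral_graph. \<forall>v \<in> pverts dodecahedral_graph.
       (u, v) \<in> parcs dodecahedral_graph \<longleftrightarrow> dist (f u) (f v) = 2 / p)"
proof -
  have p_pos: "p > 0" by (simp add: p_def add_pos_pos)
  have pp: "p * p = p + 1" by (simp add: p_def field_simps)
  then have q: "q = p - 1" using p_pos by (simp add: q_def field_simps)
  have "(2 / p)\<^sup>2 = 4 * (q * q)" by (simp add: q_def power2_eq_square)
  also have "q * q = 2 - p" using pp by (simp add: q algebra_simps)
  finally have edge2: "(2 / p)\<^sup>2 = 8 - 4 * p" by simp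
  define r :: "int \<times> int \<Rightarrow> real" where "r = (\<lambda>x. of_int (fst x) + of_int (snd x) * p)"
  have r_eq_0: "x = (0, 0)" if "r x = 0" for x
  proof -
    obtain a b where x: "x = (a, b)" by (cases x)
    have "(of_int a + of_int b * p) * (of_int a + of_int b * (1 - p)) = (0::real)"
      using that by (simp add: r_def x)
    also have "(of_int a + of_int b * p) * (of_int a + of_int b * (1 - p)) =
        of_int a * of_int a + of_int a * of_int b + of_int b * of_int b * (p - p * p)"
      by (simp add: algebra_simps)
    finally have "of_int (a * a + a * b) = (of_int (b * b) :: real)" by (simp add: pp)
    then have "a * a + a * b = b * b" by (simp only: of_int_eq_iff)
    from golden_norm_eq_0[OF this] show ?thesis by (simp add: x)
  qed
  have r_eq_iff: "r x = r y \<longleftrightarrow> x = y" for x y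
  proof
    assume "r x = r y"
    then have "r (fst x - fst y, snd x - snd y) = 0" by (simp add: r_def algebra_simps)
    from r_eq_0[OF this] show "x = y" by (simp add: prod_eq_iff)
  qed simp
  define g where "g = (\<lambda>(x, y, z). (r x, r y, r z))"
  have g_eq_iff: "g u = g v \<longleftrightarrow> u = v" for u v
    by (cases u; cases v) (simp add: g_def r_eq_iff)
  have r_square: "(r x - r y)\<^sup>2 = r (golden_square x y)" for x y
  proof -
    have *: "(a + b * p) * (a + b * p) = a * a + b * b + (2 * a * b + b * b) * p" for a b :: real
    proof -
      have "(a + b * p) * (a + b * p) = a * a + 2 * a * b * p + b * b * (p * p)"
        by (simp add: algebra_simps)
      then show ?thesis by (simp add: pp algebra_simps)
    qed
    have "r x - r y = of_int (fst x - fst y) + of_int (snd x - snd y) * p"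
      by (simp add: r_def algebra_simps)
    then show ?thesis
      unfolding power2_eq_square golden_square_def Let_def by (simp only: *) (simp add: r_def)
  qed
  have dist_g: "dist (g u) (g v) = 2 / p \<longleftrightarrow> golden_dist2 u v = (8, -4)" for u v
  proof -
    obtain x y z where u: "u = (x, y, z)" by (cases u)
    obtain x' y' z' where v: "v = (x', y', z')" by (cases v)
    have "dist (g u) (g v) = 2 / p \<longleftrightarrow> (dist (g u) (g v))\<^sup>2 = (2 / p)\<^sup>2"
      using p_pos by (subst power2_eq_iff_nonneg) auto
    also have "\<dots> \<longleftrightarrow> (dist (g u) (g v))\<^sup>2 = r (8, -4)"
      by (simp add: edge2 r_def del: power_divide)
    also have "(dist (g u) (g v))\<^sup>2 =
        r (golden_square x x') + (r (golden_square y y') + r (golden_square z z'))"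
      by (simp add: u v g_def dist_prod_def dist_real_def flip: r_square)
    also have "\<dots> = r (golden_dist2 u v)"
      by (simp add: u v golden_dist2_def r_def algebra_simps)
    finally show ?thesis by (simp only: r_eq_iff)
  qed
  define k :: "bool \<times> nat \<Rightarrow> nat" where "k = (\<lambda>(b, i). if b then 10 + i else i)"
  define f where "f = (\<lambda>u. g (dodecahedron_points ! k u))"
  have V: "pverts dodecahedral_graph = UNIV \<times> {..<10}"
    by (simp add: dodecahedral_graph_def generalized_petersen_def Let_def)
  have len: "length dodecahedron_points = 20"
    by (simp add: dodecahedron_points_def Let_def)
  have kV: "bij_betw k (pverts dodecahedral_graph) {..<length dodecahedron_points}"
    unfolding len
  proof (rule bij_betwI[where g = "\<lambda>n. if n < 10 then (False, n) else (True, n - 10)"])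
  qed (auto simp: V k_def split: if_splits)
  have "bij_betw (\<lambda>n. dodecahedron_points ! n) {..<length dodecahedron_points}
      (set dodecahedron_points)"
    using dodecahedron_points_distinct by (rule bij_betw_nth) simp_all
  from bij_betw_trans[OF kV this]
  have "bij_betw (\<lambda>u. dodecahedron_points ! k u) (pverts dodecahedral_graph)
      (set dodecahedron_points)"
    by (simp add: o_def)
  moreover have "bij_betw g (set dodecahedron_points) (g ` set dodecahedron_points)"
    by (simp add: bij_betw_def inj_on_def g_eq_iff)
  ultimately have bij: "bij_betw f (pverts dodecahedral_graph) (g ` set dodecahedron_points)"
    unfolding f_def using bij_betw_trans[unfolded o_def] by blast
  have img: "g ` set dodecahedron_points =
      {-1, 1} \<times> {-1, 1} \<times> {-1, 1} \<union> {0} \<times> {-q, q} \<times> {-p, p} \<union>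
      {-q, q} \<times> {-p, p} \<times> {0} \<union> {-p, p} \<times> {0} \<times> {-q, q}"
  proof -
    have r: "r (0, 0) = 0" "r (1, 0) = 1" "r (-1, 0) = -1" "r (0, 1) = p" "r (0, -1) = -p"
      "r (-1, 1) = q" "r (1, -1) = -q"
      by (simp_all add: r_def q)
    show ?thesis
      unfolding dodecahedron_points_def Let_def list.set image_insert image_empty g_def
        prod.case r
    proof (intro subset_antisym subsetI, goal_cases)
      case (1 t)
      then show ?case by (elim insertE emptyE) simp_all
    next
      case (2 t)
      then show ?case by (elim UnE SigmaE insertE emptyE) (simp_all only: prod.inject insert_iff simp_thms)
    qed
  qed
  have adj: "(u, v) \<in> parcs dodecahedral_graph \<longleftrightarrow> dist (f u) (f v) = 2 / p"
    if "u \<in> pverts dodecahedral_graph" "v \<in> pverts dodecahedral_graph" for u v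
  proof -
    obtain b i where u: "u = (b, i)" by (cases u)
    obtain c j where v: "v = (c, j)" by (cases v)
    have ij: "i < 10" "j < 10" using that by (auto simp: V u v)
    have "(u, v) \<in> parcs dodecahedral_graph \<longleftrightarrow> dodecahedral_adj u v"
      using ij
      by (cases b; cases c)
        (auto simp: u v dodecahedral_graph_def generalized_petersen_def Let_def dodecahedral_adj_def)
    also have "\<dots> \<longleftrightarrow> golden_dist2 (dodecahedron_points ! k u) (dodecahedron_points ! k v) = (8, -4)"
    proof -
      have "b \<in> set [False, True]" "c \<in> set [False, True]" by simp_all
      moreover have "i \<in> set [0..<10]" "j \<in> set [0..<10]" using ij by simp_all
      ultimately show ?thesis
        using dodecahedron_points_adj unfolding u v k_def prod.case by blast
    qed
    also have "\<dots> \<longleftrightarrow> dist (f u) (f v) = 2 / p"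
      by (simp only: f_def dist_g)
    finally show ?thesis .
  qed
  show ?thesis
  proof (intro exI conjI ballI)
    show "bij_betw f (pverts dodecahedral_graph)
      ({-1, 1} \<times> {-1, 1} \<times> {-1, 1} \<union> {0} \<times> {-q, q} \<times> {-p, p} \<union>
       {-q, q} \<times> {-p, p} \<times> {0} \<union> {-p, p} \<times> {0} \<times> {-q, q})"
      using bij unfolding img .
  qed (rule adj)
qed

end

theory Submission
  imports Defs "HOL-Analysis.Function_Topology"
begin

text \<open>
  If the adjacency matrix \<open>A\<close> has no eigenvalue in \<open>(-2, 0)\<close>, then \<open>A + 1\<close> has none in
  \<open>(-1, 1)\<close>, hence \<open>\<parallel>(A + 1) f\<parallel> \<ge> \<parallel>f\<parallel>\<close> for every \<open>f\<close>. For \<open>f\<close> of small support this only involves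
  a small piece of the graph, so it forbids many local configurations. Growing a partial graph by
  the missing neighbours of one vertex at a time, one obtains finite case distinctions in which
  every dead end is refuted by an explicit integer vector \<open>f\<close>. They show that two pentagons with a
  common path of length two force the Petersen graph, and that otherwise a pentagon forces an
  adjacent pentagon, then three pentagons around a vertex, and finally the dodecahedron.
\<close>

section \<open>Eigenvalues of real symmetric matrices\<close>

lemma compact_unit_sphere_finite_support:
  shows "compact {f :: nat \<Rightarrow> real. (\<forall>i\<ge>n. f i = 0) \<and> (\<Sum>i<n. (f i)\<^sup>2) = 1}" (is "compact ?S")
proof -
  let ?I = "\<lambda>i. if i < n then {-1..1} else {0 :: real}"
  have "compactin (product_topology (\<lambda>_. euclidean) UNIV) (PiE UNIV ?I)"
    unfolding compactin_PiE by simp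
  then have "compact (PiE UNIV ?I)"
    by (simp add: euclidean_product_topology)
  moreover have "closed {f :: nat \<Rightarrow> real. (\<Sum>i<n. (f i)\<^sup>2) = 1}"
    by (intro closed_Collect_eq continuous_intros continuous_on_product_coordinates)
  moreover have "?S = PiE UNIV ?I \<inter> {f. (\<Sum>i<n. (f i)\<^sup>2) = 1}"
  proof -
    have "\<bar>f i\<bar> \<le> 1" if "(\<Sum>i<n. (f i)\<^sup>2) = 1" "i < n" for f :: "nat \<Rightarrow> real" and i
      using member_le_sum[of i "{..<n}" "\<lambda>i. (f i)\<^sup>2"] that by (simp add: abs_square_le_1)
    then have "(\<forall>i\<ge>n. f i = 0) \<longleftrightarrow> (\<forall>i. f i \<in> ?I i)" if "(\<Sum>i<n. (f i)\<^sup>2) = 1" for f :: "nat \<Rightarrow> real"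
      using that by (simp add: abs_le_iff all_conj_distrib if_split[of "\<lambda>X. f _ \<in> X"] not_less)
    then show ?thesis by (auto simp: PiE_iff)
  qed
  ultimately show ?thesis by (simp add: compact_Int_closed)
qed

lemma scalar_prod_self_nonneg:
  fixes v :: "'a :: linordered_idom vec"
  shows "0 \<le> v \<bullet> v"
  by (simp add: scalar_prod_def sum_nonneg)

lemma scalar_prod_self_eq_0_iff:
  fixes v :: "'a :: linordered_idom vec"
  assumes "v \<in> carrier_vec n"
  shows "v \<bullet> v = 0 \<longleftrightarrow> v = 0\<^sub>v n"
  using assms by (auto simp: scalar_prod_def sum_nonneg_eq_0_iff intro!: eq_vecI)

lemma quadratic_form_attains_minimum_on_sphere:
  fixes A :: "real mat"
  assumes A: "A \<in> carrier_mat n n" and "0 < n"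
  obtains u where "u \<in> carrier_vec n" "u \<bullet> u = 1"
    "\<And>w. w \<in> carrier_vec n \<Longrightarrow> w \<bullet> w = 1 \<Longrightarrow> u \<bullet> (A *\<^sub>v u) \<le> w \<bullet> (A *\<^sub>v w)"
proof -
  define S where "S = {f :: nat \<Rightarrow> real. (\<forall>i\<ge>n. f i = 0) \<and> (\<Sum>i<n. (f i)\<^sup>2) = 1}"
  define q where "q f = (\<Sum>i<n. f i * (\<Sum>j<n. A $$ (i, j) * f j))" for f :: "nat \<Rightarrow> real"
  have norm_vec: "vec n f \<bullet> vec n f = (\<Sum>i<n. (f i)\<^sup>2)" for f :: "nat \<Rightarrow> real"
    by (simp add: scalar_prod_def power2_eq_square lessThan_atLeast0)
  have q_vec: "vec n f \<bullet> (A *\<^sub>v vec n f) = q f" for f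
    using A by (simp add: scalar_prod_def q_def lessThan_atLeast0)
  have "(\<Sum>i<n. (if i = 0 then 1 else 0 :: real)\<^sup>2) = (\<Sum>i<n. if i = 0 then 1 else 0)"
    by (intro sum.cong) auto
  then have "(\<lambda>i. if i = 0 then 1 else 0) \<in> S"
    using \<open>0 < n\<close> by (simp add: S_def)
  moreover have "compact S" unfolding S_def by (rule compact_unit_sphere_finite_support)
  moreover have "continuous_on S (\<lambda>f. f i)" for i
    by (rule continuous_on_subset[OF continuous_on_product_coordinates subset_UNIV])
  then have "continuous_on S q" unfolding q_def by (intro continuous_intros)
  ultimately obtain f where f: "f \<in> S" and q_min: "\<And>g. g \<in> S \<Longrightarrow> q f \<le> q g"
    using continuous_attains_inf[of S q] by blast
  show thesis
  proof (rule that[of "vec n f"])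
    show "vec n f \<bullet> vec n f = 1" using f by (simp add: norm_vec S_def)
    fix w :: "real vec" assume w: "w \<in> carrier_vec n" "w \<bullet> w = 1"
    define g where "g i = (if i < n then w $ i else 0)" for i
    have w_eq: "w = vec n g" using w(1) by (intro eq_vecI) (auto simp: g_def)
    have "(\<Sum>i<n. (g i)\<^sup>2) = 1" using w(2) by (simp only: w_eq norm_vec)
    then have "g \<in> S" by (simp add: S_def g_def)
    then show "vec n f \<bullet> (A *\<^sub>v vec n f) \<le> w \<bullet> (A *\<^sub>v w)"
      unfolding w_eq q_vec by (rule q_min)
  qed simp
qed

lemma rayleigh_quotient_attains_minimum:
  fixes A :: "real mat"
  assumes A: "A \<in> carrier_mat n n" and "0 < n"
  obtains u where "u \<in> carrier_vec n" "u \<bullet> u = 1"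
    "\<And>v. v \<in> carrier_vec n \<Longrightarrow> u \<bullet> (A *\<^sub>v u) * (v \<bullet> v) \<le> v \<bullet> (A *\<^sub>v v)"
proof -
  obtain u where u: "u \<in> carrier_vec n" "u \<bullet> u = 1"
    and min: "\<And>w. w \<in> carrier_vec n \<Longrightarrow> w \<bullet> w = 1 \<Longrightarrow> u \<bullet> (A *\<^sub>v u) \<le> w \<bullet> (A *\<^sub>v w)"
    using quadratic_form_attains_minimum_on_sphere[OF assms] by metis
  have "u \<bullet> (A *\<^sub>v u) * (v \<bullet> v) \<le> v \<bullet> (A *\<^sub>v v)" if v: "v \<in> carrier_vec n" for v
  proof (cases "v = 0\<^sub>v n")
    case True
    then show ?thesis using A by simp
  next
    case False
    define r where "r = sqrt (v \<bullet> v)"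
    define w where "w = (1 / r) \<cdot>\<^sub>v v"
    have w: "w \<in> carrier_vec n" using v by (simp add: w_def)
    have pos: "0 < v \<bullet> v"
      using False scalar_prod_self_eq_0_iff[OF v] scalar_prod_self_nonneg[of v] by simp
    then have r_square: "r * r = v \<bullet> v" by (simp add: r_def)
    have "w \<bullet> w = (v \<bullet> v) / (r * r)" by (simp add: w_def)
    then have "w \<bullet> w = 1" using pos by (simp add: r_square)
    with w have "u \<bullet> (A *\<^sub>v u) \<le> w \<bullet> (A *\<^sub>v w)" by (rule min)
    also have "w \<bullet> (A *\<^sub>v w) = v \<bullet> (A *\<^sub>v v) / (r * r)"
      using A v by (simp add: w_def mult_mat_vec[OF A])
    finally show ?thesis using pos by (simp add: r_square pos_le_divide_eq)
  qed
  with u show thesis by (rule that)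
qed

lemma rayleigh_minimizer_eigenvector:
  fixes A :: "real mat"
  assumes A: "A \<in> carrier_mat n n" and sym: "A\<^sup>T = A" and u: "u \<in> carrier_vec n"
    and lower: "\<And>v. v \<in> carrier_vec n \<Longrightarrow> k * (v \<bullet> v) \<le> v \<bullet> (A *\<^sub>v v)"
    and attained: "u \<bullet> (A *\<^sub>v u) = k * (u \<bullet> u)"
  shows "A *\<^sub>v u = k \<cdot>\<^sub>v u"
proof -
  define w where "w = A *\<^sub>v u - k \<cdot>\<^sub>v u"
  define g where "g t = 2 * t * (w \<bullet> w) + t\<^sup>2 * (w \<bullet> (A *\<^sub>v w) - k * (w \<bullet> w))" for t :: real
  have w: "w \<in> carrier_vec n" and Au: "A *\<^sub>v u \<in> carrier_vec n" and Aw: "A *\<^sub>v w \<in> carrier_vec n"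
    using A u by (auto simp: w_def)
  have Au_eq: "A *\<^sub>v u = w + k \<cdot>\<^sub>v u" using A u by (intro eq_vecI) (auto simp: w_def)
  have uAw: "u \<bullet> (A *\<^sub>v w) = w \<bullet> (A *\<^sub>v u)"
    using transpose_vec_mult_scalar[OF A w u] Au w by (simp add: sym comm_scalar_prod)
  have "0 \<le> g t" for t
  proof -
    let ?v = "u + t \<cdot>\<^sub>v w"
    have "?v \<bullet> (A *\<^sub>v ?v) =
        u \<bullet> (A *\<^sub>v u) + t * (u \<bullet> (A *\<^sub>v w)) + t * (w \<bullet> (A *\<^sub>v u)) + t\<^sup>2 * (w \<bullet> (A *\<^sub>v w))"
      using A u w Au Aw
      by (simp add: mult_mat_vec add_scalar_prod_distrib[of _ n]
          scalar_prod_add_distrib[of _ n] power2_eq_square algebra_simps)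
    moreover have "?v \<bullet> ?v = u \<bullet> u + 2 * t * (w \<bullet> u) + t\<^sup>2 * (w \<bullet> w)"
      using u w
      by (simp add: add_scalar_prod_distrib[of _ n] scalar_prod_add_distrib[of _ n]
          comm_scalar_prod[of u n w] power2_eq_square algebra_simps)
    moreover have "w \<bullet> (A *\<^sub>v u) = w \<bullet> w + k * (w \<bullet> u)"
      unfolding Au_eq using u w by (simp add: scalar_prod_add_distrib[of _ n])
    ultimately have "?v \<bullet> (A *\<^sub>v ?v) - k * (?v \<bullet> ?v) = g t"
      by (simp add: g_def attained uAw algebra_simps)
    then show ?thesis using lower[of ?v] u w by simp
  qed
  moreover have "(g has_real_derivative 2 * (w \<bullet> w)) (at 0)"
    unfolding g_def by (auto intro!: derivative_eq_intros)
  ultimately have "2 * (w \<bullet> w) = 0"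
    by (intro DERIV_local_min[of g _ 0 1]) (simp_all add: g_def[of 0])
  then have "w = 0\<^sub>v n" using scalar_prod_self_eq_0_iff[OF w] by simp
  then show ?thesis using Au_eq u by simp
qed

lemma symmetric_eigenvalue_less:
  fixes A :: "real mat"
  assumes A: "A \<in> carrier_mat n n" and sym: "A\<^sup>T = A"
    and v: "v \<in> carrier_vec n" "v \<bullet> (A *\<^sub>v v) < c * (v \<bullet> v)"
  obtains k where "k < c" "eigenvalue A k"
proof -
  have "0 < n" using A v by (cases n) (auto simp: scalar_prod_def)
  then obtain u where u: "u \<in> carrier_vec n" "u \<bullet> u = 1"
    and min: "\<And>v. v \<in> carrier_vec n \<Longrightarrow> u \<bullet> (A *\<^sub>v u) * (v \<bullet> v) \<le> v \<bullet> (A *\<^sub>v v)"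
    using rayleigh_quotient_attains_minimum[OF A] by metis
  define k where "k = u \<bullet> (A *\<^sub>v u)"
  have "k * (v \<bullet> v) < c * (v \<bullet> v)" using min[OF v(1)] v(2) by (simp add: k_def)
  then have "k < c" by (rule mult_right_less_imp_less) (rule scalar_prod_self_nonneg)
  moreover have "A *\<^sub>v u = k \<cdot>\<^sub>v u"
    using min u by (intro rayleigh_minimizer_eigenvector[OF A sym]) (simp_all add: k_def)
  then have "eigenvalue A k"
    using A u by (auto simp: eigenvalue_def eigenvector_def)
  ultimately show thesis by (rule that)
qed

lemma eigenvalue_add_smult_one:
  fixes A :: "'a :: field mat"
  assumes A: "A \<in> carrier_mat n n"
  shows "eigenvalue (A + c \<cdot>\<^sub>m 1\<^sub>m n) k \<longleftrightarrow> eigenvalue A (k - c)"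
proof -
  have "char_matrix (A + c \<cdot>\<^sub>m 1\<^sub>m n) k = char_matrix A (k - c)"
    using A by (intro eq_matI) (auto simp: char_matrix_def)
  then show ?thesis using A by (simp add: eigenvalue_det[of _ n])
qed

lemma eigenvalue_square:
  fixes A :: "'a :: field mat"
  assumes A: "A \<in> carrier_mat n n" and "eigenvalue (A * A) (k * k)"
  shows "eigenvalue A k \<or> eigenvalue A (- k)"
proof -
  have "char_matrix (A * A) (k * k) = char_matrix A k * char_matrix A (- k)"
    using A
    by (simp add: char_matrix_def add_mult_distrib_mat[of _ n n] mult_add_distrib_mat[of _ n n])
      (auto simp: algebra_simps)
  then have "det (char_matrix A k) * det (char_matrix A (- k)) = 0"
    using A assms(2) by (simp add: eigenvalue_det[of _ n] flip: det_mult[of _ n])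
  then show ?thesis using A by (simp add: eigenvalue_det[of _ n])
qed

lemma symmetric_eigenvalue_abs_less:
  fixes A :: "real mat"
  assumes A: "A \<in> carrier_mat n n" and sym: "A\<^sup>T = A" and "0 \<le> c"
    and v: "v \<in> carrier_vec n" "(A *\<^sub>v v) \<bullet> (A *\<^sub>v v) < c\<^sup>2 * (v \<bullet> v)"
  obtains k where "\<bar>k\<bar> < c" "eigenvalue A k"
proof -
  have square_carrier: "A * A \<in> carrier_mat n n" using A by simp
  have form: "x \<bullet> (A * A *\<^sub>v x) = (A *\<^sub>v x) \<bullet> (A *\<^sub>v x)" if "x \<in> carrier_vec n" for x
    using transpose_vec_mult_scalar[OF A _ that, of "A *\<^sub>v x"] A that by (simp add: sym)
  have "(A * A)\<^sup>T = A * A" using A by (simp add: transpose_mult[of _ n n] sym)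
  then obtain m where m: "m < c\<^sup>2" "eigenvalue (A * A) m"
    using symmetric_eigenvalue_less[OF square_carrier _ v(1)] v form by metis
  then obtain x where x: "x \<in> carrier_vec n" "x \<noteq> 0\<^sub>v n" "A * A *\<^sub>v x = m \<cdot>\<^sub>v x"
    using A by (auto simp: eigenvalue_def eigenvector_def)
  have "0 \<le> (A *\<^sub>v x) \<bullet> (A *\<^sub>v x)" by (rule scalar_prod_self_nonneg)
  also have "\<dots> = m * (x \<bullet> x)" using x by (simp flip: form)
  finally have "0 \<le> m * (x \<bullet> x)" .
  moreover have "0 < x \<bullet> x"
    using scalar_prod_self_eq_0_iff[OF x(1)] x(2) scalar_prod_self_nonneg[of x] by simp
  ultimately have "0 \<le> m" by (simp add: zero_le_mult_iff)
  then have "eigenvalue A (sqrt m) \<or> eigenvalue A (- sqrt m)"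
    using m(2) by (intro eigenvalue_square[OF A]) simp
  moreover have "sqrt m < c" "- sqrt m > - c" using m(1) \<open>0 \<le> c\<close> by (simp_all add: real_less_lsqrt)
  moreover have "0 \<le> sqrt m" using \<open>0 \<le> m\<close> by simp
  ultimately show thesis using that by (metis abs_minus_cancel abs_of_nonneg)
qed

section \<open>The adjacency matrix\<close>

definition vertex_vec :: "'a list \<Rightarrow> ('a \<Rightarrow> real) \<Rightarrow> real vec" where
  "vertex_vec vs f = vec (length vs) (\<lambda>i. f (vs ! i))"

lemma vertex_vec_carrier [simp]: "vertex_vec vs f \<in> carrier_vec (length vs)"
  by (simp add: vertex_vec_def)

lemma adjacency_matrix_carrier [simp]: "adjacency_matrix G vs \<in> carrier_mat (length vs) (length vs)"
  by (simp add: adjacency_matrix_def)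

lemma sum_nth_eq_sum_set:
  assumes "distinct xs"
  shows "(\<Sum>i<length xs. f (xs ! i)) = sum f (set xs)"
  using assms by (intro sum.reindex_bij_betw bij_betw_nth) auto

lemma scalar_prod_vertex_vec:
  assumes "distinct vs"
  shows "vertex_vec vs f \<bullet> vertex_vec vs g = (\<Sum>x\<in>set vs. f x * g x)"
  using sum_nth_eq_sum_set[OF assms, of "\<lambda>x. f x * g x"]
  by (simp add: vertex_vec_def scalar_prod_def lessThan_atLeast0)

lemma adjacency_matrix_mult_vertex_vec:
  assumes "distinct vs"
  shows "adjacency_matrix G vs *\<^sub>v vertex_vec vs f =
    vertex_vec vs (\<lambda>x. \<Sum>y | y \<in> set vs \<and> (x, y) \<in> parcs G. f y)"
proof (rule eq_vecI)
  fix i assume "i < dim_vec (vertex_vec vs (\<lambda>x. \<Sum>y | y \<in> set vs \<and> (x, y) \<in> parcs G. f y))"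
  then have i: "i < length vs" by (simp add: vertex_vec_def)
  then have "(adjacency_matrix G vs *\<^sub>v vertex_vec vs f) $ i =
      (\<Sum>j<length vs. (if (vs ! i, vs ! j) \<in> parcs G then 1 else 0) * f (vs ! j))"
    by (simp add: adjacency_matrix_def vertex_vec_def scalar_prod_def lessThan_atLeast0)
  also have "\<dots> = (\<Sum>y\<in>set vs. (if (vs ! i, y) \<in> parcs G then 1 else 0) * f y)"
    by (rule sum_nth_eq_sum_set[OF assms])
  also have "\<dots> = (\<Sum>y | y \<in> set vs \<and> (vs ! i, y) \<in> parcs G. f y)"
    by (intro sum.mono_neutral_cong_right) auto
  finally show "(adjacency_matrix G vs *\<^sub>v vertex_vec vs f) $ i =
      vertex_vec vs (\<lambda>x. \<Sum>y | y \<in> set vs \<and> (x, y) \<in> parcs G. f y) $ i"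
    using i by (simp add: vertex_vec_def)
qed (simp add: vertex_vec_def adjacency_matrix_def)

lemma sum_squares_le_if_no_eigenvalue:
  fixes f :: "'a \<Rightarrow> real"
  assumes "distinct vs" and "sym (parcs G)"
    and gap: "\<And>k. eigenvalue (adjacency_matrix G vs) k \<Longrightarrow> k \<notin> {-2<..<0}"
  shows "(\<Sum>x\<in>set vs. (f x)\<^sup>2) \<le> (\<Sum>x\<in>set vs. (f x + (\<Sum>y | y \<in> set vs \<and> (x, y) \<in> parcs G. f y))\<^sup>2)"
proof (rule ccontr)
  let ?A = "adjacency_matrix G vs" and ?n = "length vs" and ?v = "vertex_vec vs f"
  let ?g = "\<lambda>x. f x + (\<Sum>y | y \<in> set vs \<and> (x, y) \<in> parcs G. f y)"
  define B where "B = ?A + 1\<^sub>m ?n"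
  have B: "B \<in> carrier_mat ?n ?n" by (simp add: B_def)
  have "B\<^sup>T = B"
    using assms(2) by (intro eq_matI) (auto simp: B_def adjacency_matrix_def dest: symD)
  have "B *\<^sub>v ?v = ?A *\<^sub>v ?v + ?v"
    unfolding B_def by (subst add_mult_distrib_mat_vec[of _ ?n ?n]) simp_all
  also have "\<dots> = vertex_vec vs ?g"
    unfolding adjacency_matrix_mult_vertex_vec[OF assms(1)] by (auto simp: vertex_vec_def)
  finally have Bv: "B *\<^sub>v ?v = vertex_vec vs ?g" .
  assume "\<not> ?thesis"
  then have "(B *\<^sub>v ?v) \<bullet> (B *\<^sub>v ?v) < 1\<^sup>2 * (?v \<bullet> ?v)"
    unfolding Bv scalar_prod_vertex_vec[OF assms(1)] by (simp add: power2_eq_square)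
  then obtain k where "\<bar>k\<bar> < 1" "eigenvalue B k"
    using symmetric_eigenvalue_abs_less[OF B \<open>B\<^sup>T = B\<close>, of 1 ?v] by auto
  moreover have "B = ?A + 1 \<cdot>\<^sub>m 1\<^sub>m ?n" by (auto simp: B_def)
  ultimately have "eigenvalue ?A (k - 1)" "k - 1 \<in> {-2<..<0}"
    by (auto simp: eigenvalue_add_smult_one[of _ ?n])
  then show False using gap by blast
qed

section \<open>Cycles, connectedness and isomorphisms\<close>

lemma girth_le_cycle:
  assumes "pre_digraph.cycle (with_proj G) p" "3 \<le> length p"
  shows "girth G \<le> enat (length p)"
  unfolding girth_def using assms by (intro INF_lower) simp

lemma girth_attained:
  assumes "girth G = enat n"
  obtains p where "pre_digraph.cycle (with_proj G) p" "length p = n"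
proof -
  let ?A = "(\<lambda>p. enat (length p)) ` {p. pre_digraph.cycle (with_proj G) p \<and> 3 \<le> length p}"
  have "Inf ?A = enat n" using assms by (simp add: girth_def)
  then have "?A \<noteq> {}" by (metis Inf_empty enat.distinct(1) top_enat_def)
  then have "Inf ?A \<in> ?A"
    unfolding Inf_enat_def by (auto intro: LeastI)
  then show thesis using \<open>Inf ?A = enat n\<close> that by auto
qed

context pair_wf_digraph
begin

lemma cycle_of_three:
  assumes "(x, y) \<in> parcs G" "(y, z) \<in> parcs G" "(z, x) \<in> parcs G" "distinct [x, y, z]"
  shows "cycle [(x, y), (y, z), (z, x)]"
  using assms in_arcsD1 by (auto simp: cycle_def awalk_def)

lemma cycle_of_four:
  assumes "(x, y) \<in> parcs G" "(y, z) \<in> parcs G" "(z, w) \<in> parcs G" "(w, x) \<in> parcs G"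
    "distinct [x, y, z, w]"
  shows "cycle [(x, y), (y, z), (z, w), (w, x)]"
  using assms in_arcsD1 by (auto simp: cycle_def awalk_def)

lemma cycle_length_five:
  assumes "cycle p" "length p = 5"
  obtains a b c d e where "distinct [a, b, c, d, e]"
    "(a, b) \<in> parcs G" "(b, c) \<in> parcs G" "(c, d) \<in> parcs G" "(d, e) \<in> parcs G" "(e, a) \<in> parcs G"
proof -
  obtain u where u: "set p \<subseteq> parcs G" "pcas u p u" "distinct (tl (pawalk_verts u p))"
    using assms(1) by (auto simp: cycle_def awalk_def)
  obtain e1 e2 e3 e4 e5 where p: "p = [e1, e2, e3, e4, e5]"
    using assms(2) by (auto simp: eval_nat_numeral length_Suc_conv)
  have "\<exists>a b c d e. p = [(a, b), (b, c), (c, d), (d, e), (e, a)]"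
    using u(2) unfolding p by (cases e1; cases e2; cases e3; cases e4; cases e5) auto
  then obtain a b c d e where "p = [(a, b), (b, c), (c, d), (d, e), (e, a)]" by blast
  with u show thesis by (intro that[of a b c d e]) auto
qed

end

lemma (in pair_sym_digraph) connected_closed_set:
  assumes conn: "Digraph_Component.connected (with_proj G)"
    and S: "S \<subseteq> pverts G" "S \<noteq> {}"
    and closed: "\<And>x y. x \<in> S \<Longrightarrow> (x, y) \<in> parcs G \<Longrightarrow> y \<in> S"
  shows "S = pverts G"
proof (intro subset_antisym S(1) subsetI)
  fix y assume "y \<in> pverts G"
  obtain x where x: "x \<in> S" using S(2) by blast
  have "strongly_connected (with_proj G)"
    using pair_sym_arcs conn by (rule symmetric_connected_imp_strongly_connected)
  then have "x \<rightarrow>\<^sup>*\<^bsub>with_proj G\<^esub> y" using x S(1) \<open>y \<in> pverts G\<close> by (auto simp: strongly_connected_def)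
  then show "y \<in> S"
    by (induction rule: reachable_induct) (use x closed in \<open>auto simp: arcs_ends_conv\<close>)
qed

lemma digraph_iso_with_projI:
  assumes "pair_wf_digraph G" and "pair_wf_digraph H" and f: "bij_betw f (pverts G) (pverts H)"
    and adj: "\<And>u v. u \<in> pverts G \<Longrightarrow> v \<in> pverts G \<Longrightarrow> (f u, f v) \<in> parcs H \<longleftrightarrow> (u, v) \<in> parcs G"
  shows "digraph_iso (with_proj G) (with_proj H)"
proof -
  interpret G: pair_wf_digraph G by fact
  interpret H: pair_wf_digraph H by fact
  have arcs_G: "parcs G \<subseteq> pverts G \<times> pverts G" by (auto dest: G.in_arcsD1 G.in_arcsD2)
  define hom where "hom = \<lparr>iso_verts = f, iso_arcs = map_prod f f, iso_head = snd, iso_tail = fst\<rparr>"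
  have inj: "inj_on f (pverts G)" and im: "f ` pverts G = pverts H"
    using f by (auto simp: bij_betw_def)
  have "inj_on (map_prod f f) (parcs G)"
    using map_prod_inj_on[OF inj inj] arcs_G by (rule inj_on_subset)
  then have "G.digraph_isomorphism hom"
    using G.wf_digraph inj by (simp add: G.digraph_isomorphism_def hom_def)
  moreover have "map_prod f f ` parcs G = parcs H"
  proof (intro subset_antisym subsetI)
    fix e assume "e \<in> map_prod f f ` parcs G"
    then show "e \<in> parcs H" using adj arcs_G by auto
  next
    fix e assume "e \<in> parcs H"
    then have "fst e \<in> f ` pverts G" "snd e \<in> f ` pverts G"
      using H.arc_fst_in_verts H.arc_snd_in_verts im by auto
    then obtain u v where "u \<in> pverts G" "v \<in> pverts G" "e = map_prod f f (u, v)"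
      by (metis imageE map_prod_simp prod.collapse)
    then show "e \<in> map_prod f f ` parcs G" using adj \<open>e \<in> parcs H\<close> by auto
  qed
  then have "with_proj H = app_iso hom (with_proj G)"
    using im by (simp add: app_iso_def hom_def with_proj_def)
  ultimately show ?thesis unfolding digraph_iso_def by blast
qed

section \<open>Cubic graphs of girth at least five\<close>

definition (in pair_pre_digraph) nbrs :: "'a \<Rightarrow> 'a set" where
  "nbrs x = {y. (x, y) \<in> parcs G}"

lemma (in pair_pre_digraph) card_nbrs: "card (nbrs x) = out_degree (with_proj G) x"
proof -
  have "out_arcs (with_proj G) x = Pair x ` nbrs x" by (auto simp: out_arcs_def nbrs_def)
  then show ?thesis by (simp add: out_degree_def card_image inj_on_def)
qed

lemma (in pair_wf_digraph) nbrs_subset: "nbrs x \<subseteq> pverts G"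
  by (auto simp: nbrs_def dest: in_arcsD2)

lemma (in pair_sym_digraph) nbrs_sym: "y \<in> nbrs x \<Longrightarrow> x \<in> nbrs y"
  by (simp add: nbrs_def arcs_symmetric)

locale cubic_graph_girth_ge_5 = pair_graph +
  assumes cubic: "x \<in> pverts G \<Longrightarrow> out_degree (with_proj G) x = 3"
    and girth_ge_5: "5 \<le> girth G"
begin

lemma finite_nbrs: "finite (nbrs x)"
  using nbrs_subset pair_finite_verts by (rule finite_subset)

lemma nbrs_irrefl: "x \<notin> nbrs x"
  using pair_no_loops[of "(x, x)"] by (auto simp: nbrs_def)

lemma cycle_length_ge_5:
  assumes "cycle p" "3 \<le> length p"
  shows "5 \<le> length p"
proof -
  have "5 \<le> enat (length p)" using girth_ge_5 girth_le_cycle[OF assms] by (rule order_trans)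
  then show ?thesis by (simp add: numeral_eq_enat)
qed

lemma no_triangle:
  assumes "y \<in> nbrs x" "z \<in> nbrs x"
  shows "z \<notin> nbrs y"
proof
  assume "z \<in> nbrs y"
  then have "cycle [(x, y), (y, z), (z, x)]"
    using assms nbrs_irrefl arcs_symmetric by (intro cycle_of_three) (auto simp: nbrs_def)
  with cycle_length_ge_5 show False by fastforce
qed

lemma common_nbr_unique:
  assumes "x \<noteq> z" "y \<in> nbrs x \<inter> nbrs z" "w \<in> nbrs x \<inter> nbrs z"
  shows "y = w"
proof (rule ccontr)
  assume "y \<noteq> w"
  then have "cycle [(x, y), (y, z), (z, w), (w, x)]"
    using assms nbrs_irrefl arcs_symmetric by (intro cycle_of_four) (auto simp: nbrs_def)
  with cycle_length_ge_5 show False by fastforce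
qed

end

section \<open>Partial graphs\<close>

type_synonym adj_lists = "nat list list"

definition subcubic :: "adj_lists \<Rightarrow> bool" where
  "subcubic g \<longleftrightarrow> (\<forall>i<length g. length (g ! i) \<le> 3 \<and> distinct (g ! i) \<and>
     (\<forall>j\<in>set (g ! i). j < length g \<and> i \<in> set (g ! j)))"

lemma subcubicD:
  assumes "subcubic g" "i < length g"
  shows "length (g ! i) \<le> 3" "distinct (g ! i)"
    "j \<in> set (g ! i) \<Longrightarrow> j < length g" "j \<in> set (g ! i) \<Longrightarrow> i \<in> set (g ! j)"
  using assms unfolding subcubic_def by blast+

definition (in pair_pre_digraph) embedding :: "(nat \<Rightarrow> 'a) \<Rightarrow> adj_lists \<Rightarrow> bool" where
  "embedding \<phi> g \<longleftrightarrow> inj_on \<phi> {..<length g} \<and> \<phi> ` {..<length g} \<subseteq> pverts G \<and>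
     (\<forall>i<length g. \<forall>j\<in>set (g ! i). \<phi> j \<in> nbrs (\<phi> i))"

definition (in pair_pre_digraph) contains :: "adj_lists \<Rightarrow> bool" where
  "contains g \<longleftrightarrow> (\<exists>\<phi>. embedding \<phi> g)"

lemma (in pair_pre_digraph) embedding_eq_iff:
  "embedding \<phi> g \<Longrightarrow> i < length g \<Longrightarrow> j < length g \<Longrightarrow> \<phi> i = \<phi> j \<longleftrightarrow> i = j"
  by (simp add: embedding_def inj_on_eq_iff[of \<phi> "{..<length g}"])

lemma (in pair_pre_digraph) embedding_vertex: "embedding \<phi> g \<Longrightarrow> i < length g \<Longrightarrow> \<phi> i \<in> pverts G"
  by (simp add: embedding_def image_subset_iff)

lemma (in pair_pre_digraph) embedding_edge:
  "embedding \<phi> g \<Longrightarrow> i < length g \<Longrightarrow> j \<in> set (g ! i) \<Longrightarrow> \<phi> j \<in> nbrs (\<phi> i)"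
  by (simp add: embedding_def)

definition closes_short_cycle :: "adj_lists \<Rightarrow> nat \<Rightarrow> nat \<Rightarrow> bool" where
  "closes_short_cycle g v w \<longleftrightarrow> w = v \<or> w \<in> set (g ! v) \<or>
     (\<exists>u\<in>set (g ! v). w \<in> set (g ! u) \<or> (\<exists>x\<in>set (g ! u). x \<noteq> v \<and> w \<in> set (g ! x)))"

definition add_edge :: "adj_lists \<Rightarrow> nat \<Rightarrow> nat \<Rightarrow> adj_lists" where
  "add_edge g v w = g[v := g ! v @ [w], w := g ! w @ [v]]"

definition add_leaves :: "adj_lists \<Rightarrow> nat \<Rightarrow> nat \<Rightarrow> adj_lists" where
  "add_leaves g v k = g[v := g ! v @ [length g..<length g + k]] @ replicate k [v]"

definition extensions :: "adj_lists \<Rightarrow> nat \<Rightarrow> adj_lists list" where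
  "extensions g v =
     map (add_edge g v)
       (filter (\<lambda>w. length (g ! w) < 3 \<and> \<not> closes_short_cycle g v w) [0..<length g]) @
     [add_leaves g v (3 - length (g ! v))]"

lemma length_add_edge [simp]: "length (add_edge g v w) = length g"
  by (simp add: add_edge_def)

lemma length_add_leaves [simp]: "length (add_leaves g v k) = length g + k"
  by (simp add: add_leaves_def)

lemma nbr_add_edge_cases:
  assumes "j \<in> set (add_edge g v w ! i)" "i < length g" "v \<noteq> w"
  obtains "j \<in> set (g ! i)" | "i = v" "j = w" | "i = w" "j = v"
  using assms by (cases "i = v"; cases "i = w") (auto simp: add_edge_def)

lemma nbr_add_leaves_cases:
  assumes "j \<in> set (add_leaves g v k ! i)" "i < length g + k" "v < length g"
  obtains (old) "i < length g" "j \<in> set (g ! i)"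
    | (leaf) "i = v" "length g \<le> j" "j < length g + k"
    | (stem) "length g \<le> i" "j = v"
  using assms
  by (auto simp: add_leaves_def nth_append nth_list_update not_less split: if_splits)

definition extend_map :: "(nat \<Rightarrow> 'a) \<Rightarrow> nat \<Rightarrow> 'a list \<Rightarrow> nat \<Rightarrow> 'a" where
  "extend_map \<phi> n ys i = (if i < n then \<phi> i else ys ! (i - n))"

lemma extend_map_old [simp]: "i < n \<Longrightarrow> extend_map \<phi> n ys i = \<phi> i"
  by (simp add: extend_map_def)

lemma extend_map_new: "n \<le> i \<Longrightarrow> i < n + length ys \<Longrightarrow> extend_map \<phi> n ys i \<in> set ys"
  by (simp add: extend_map_def)

lemma inj_on_extend_map:
  assumes inj: "inj_on \<phi> {..<n}" and ys: "distinct ys" "set ys \<inter> \<phi> ` {..<n} = {}"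
  shows "inj_on (extend_map \<phi> n ys) {..<n + length ys}"
proof (rule inj_onI)
  fix i j
  assume ij: "i \<in> {..<n + length ys}" "j \<in> {..<n + length ys}"
    and eq: "extend_map \<phi> n ys i = extend_map \<phi> n ys j"
  have "extend_map \<phi> n ys a \<noteq> extend_map \<phi> n ys b" if "a < n" "n \<le> b" "b < n + length ys" for a b
    using that(1) extend_map_new[OF that(2,3), of \<phi>] ys(2)
    by (metis disjoint_iff extend_map_old imageI lessThan_iff)
  then have "i < n \<longleftrightarrow> j < n" using ij eq by (metis lessThan_iff not_le)
  then show "i = j"
    using ij eq inj nth_eq_iff_index_eq[OF ys(1)]
    by (cases "i < n") (auto simp: extend_map_def dest: inj_onD)
qed

context pair_sym_digraph
begin

lemma embedding_add_edge:
  assumes \<phi>: "embedding \<phi> g" and "v \<noteq> w" and vw: "\<phi> w \<in> nbrs (\<phi> v)"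
  shows "embedding \<phi> (add_edge g v w)"
proof -
  have "\<phi> j \<in> nbrs (\<phi> i)" if "i < length g" "j \<in> set (add_edge g v w ! i)" for i j
    using that(2,1) \<open>v \<noteq> w\<close>
    by (cases rule: nbr_add_edge_cases) (use embedding_edge[OF \<phi> that(1)] vw nbrs_sym in auto)
  then show ?thesis using \<phi> by (simp add: embedding_def)
qed

lemma embedding_add_leaves:
  assumes \<phi>: "embedding \<phi> g" and g: "subcubic g" and v: "v < length g"
    and ys: "distinct ys" "set ys \<subseteq> nbrs (\<phi> v) - \<phi> ` {..<length g}"
  shows "embedding (extend_map \<phi> (length g) ys) (add_leaves g v (length ys))"
    (is "embedding ?\<psi> ?h")
  unfolding embedding_def length_add_leaves
proof (intro conjI allI impI ballI)
  have leaf_nbr: "?\<psi> i \<in> nbrs (\<phi> v)" if "length g \<le> i" "i < length g + length ys" for i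
    using extend_map_new[OF that, of \<phi>] ys(2) by blast
  show "inj_on ?\<psi> {..<length g + length ys}"
    using \<phi> ys by (intro inj_on_extend_map) (auto simp: embedding_def)
  show "?\<psi> ` {..<length g + length ys} \<subseteq> pverts G"
  proof (rule image_subsetI)
    fix i assume "i \<in> {..<length g + length ys}"
    then show "?\<psi> i \<in> pverts G"
      using embedding_vertex[OF \<phi>, of i] leaf_nbr[of i] nbrs_subset by (cases "i < length g") auto
  qed
  fix i j assume i: "i < length g + length ys" and "j \<in> set (?h ! i)"
  from this(2,1) v show "?\<psi> j \<in> nbrs (?\<psi> i)"
  proof (cases rule: nbr_add_leaves_cases)
    case old
    then show ?thesis using embedding_edge[OF \<phi> old] subcubicD(3)[OF g old] by simp
  next
    case leaf
    then show ?thesis using leaf_nbr[of j] v by simp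
  next
    case stem
    then show ?thesis using leaf_nbr[of i] i v nbrs_sym by simp
  qed
qed

end

context cubic_graph_girth_ge_5
begin

lemma card_image_adj_list:
  assumes \<phi>: "embedding \<phi> g" and g: "subcubic g" and i: "i < length g"
  shows "card (\<phi> ` set (g ! i)) = length (g ! i)"
proof -
  have "inj_on \<phi> (set (g ! i))"
    using embedding_eq_iff[OF \<phi>] subcubicD(3)[OF g i] by (auto intro!: inj_onI)
  then show ?thesis using subcubicD(2)[OF g i] by (simp add: card_image distinct_card)
qed

lemma nbrs_saturated:
  assumes \<phi>: "embedding \<phi> g" and g: "subcubic g" and i: "i < length g" "length (g ! i) = 3"
  shows "nbrs (\<phi> i) = \<phi> ` set (g ! i)"
proof (rule card_subset_eq[OF finite_nbrs, symmetric])
  show "\<phi> ` set (g ! i) \<subseteq> nbrs (\<phi> i)" using embedding_edge[OF \<phi> i(1)] by blast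
  show "card (\<phi> ` set (g ! i)) = card (nbrs (\<phi> i))"
    using card_image_adj_list[OF \<phi> g i(1)] i(2) cubic[OF embedding_vertex[OF \<phi> i(1)]]
    by (simp add: card_nbrs)
qed

lemma saturated_edge:
  assumes \<phi>: "embedding \<phi> g" and g: "subcubic g" and i: "i < length g"
    and j: "j < length g" "length (g ! j) = 3" and ij: "\<phi> j \<in> nbrs (\<phi> i)"
  shows "j \<in> set (g ! i)"
proof -
  have "\<phi> i \<in> \<phi> ` set (g ! j)" using nbrs_sym[OF ij] nbrs_saturated[OF \<phi> g j] by simp
  then have "i \<in> set (g ! j)" using embedding_eq_iff[OF \<phi> i] subcubicD(3)[OF g j(1)] by auto
  then show ?thesis by (rule subcubicD(4)[OF g j(1)])
qed

lemma not_closes_short_cycle: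
  assumes \<phi>: "embedding \<phi> g" and g: "subcubic g" and v: "v < length g" and w: "w < length g"
    and vw: "\<phi> w \<in> nbrs (\<phi> v)" and new: "w \<notin> set (g ! v)"
  shows "\<not> closes_short_cycle g v w"
proof
  note inside = subcubicD(3)[OF g] and edge = embedding_edge[OF \<phi>]
  assume "closes_short_cycle g v w"
  then consider (loop) "w = v" | (triangle) u where "u \<in> set (g ! v)" "w \<in> set (g ! u)"
    | (square) u x where "u \<in> set (g ! v)" "x \<in> set (g ! u)" "x \<noteq> v" "w \<in> set (g ! x)"
    using new unfolding closes_short_cycle_def by blast
  then show False
  proof cases
    case loop
    then show False using vw nbrs_irrefl by simp
  next
    case triangle
    then show False using no_triangle edge v inside vw by blast
  next
    case square
    then have u: "u < length g" and x: "x < length g" using inside v by blast+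
    have "\<phi> u = \<phi> w"
    proof (rule common_nbr_unique)
      show "\<phi> v \<noteq> \<phi> x" using square embedding_eq_iff[OF \<phi> v x] by simp
      show "\<phi> u \<in> nbrs (\<phi> v) \<inter> nbrs (\<phi> x)" using square edge v u nbrs_sym by blast
      show "\<phi> w \<in> nbrs (\<phi> v) \<inter> nbrs (\<phi> x)" using square edge x vw by blast
    qed
    then show False using square new embedding_eq_iff[OF \<phi> u w] by simp
  qed
qed

lemma contains_extension:
  assumes "contains g" and g: "subcubic g" and v: "v < length g"
  obtains h where "h \<in> set (extensions g v)" "contains h"
proof -
  obtain \<phi> where \<phi>: "embedding \<phi> g" using assms(1) by (auto simp: contains_def)
  show thesis
  proof (cases "\<exists>w<length g. \<phi> w \<in> nbrs (\<phi> v) \<and> w \<notin> set (g ! v)")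
    case True
    then obtain w where w: "w < length g" "\<phi> w \<in> nbrs (\<phi> v)" "w \<notin> set (g ! v)" by blast
    then have "length (g ! w) < 3"
      using saturated_edge[OF \<phi> g v] subcubicD(1)[OF g] by (metis le_neq_implies_less)
    moreover have "\<not> closes_short_cycle g v w" using w by (rule not_closes_short_cycle[OF \<phi> g v])
    ultimately have "add_edge g v w \<in> set (extensions g v)" using w by (simp add: extensions_def)
    moreover have "v \<noteq> w" using w(2) nbrs_irrefl by auto
    then have "contains (add_edge g v w)"
      using embedding_add_edge[OF \<phi> _ w(2)] by (auto simp: contains_def)
    ultimately show thesis by (rule that)
  next
    case False
    let ?old = "\<phi> ` set (g ! v)"
    have old: "?old \<subseteq> nbrs (\<phi> v)" using embedding_edge[OF \<phi> v] by blast
    obtain ys where ys: "set ys = nbrs (\<phi> v) - ?old" "distinct ys"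
      using finite_distinct_list[of "nbrs (\<phi> v) - ?old"] finite_nbrs by blast
    have "length ys = 3 - length (g ! v)"
      using ys old card_image_adj_list[OF \<phi> g v] cubic[OF embedding_vertex[OF \<phi> v]]
      by (simp add: card_Diff_subset card_nbrs flip: distinct_card)
    moreover have "set ys \<subseteq> nbrs (\<phi> v) - \<phi> ` {..<length g}" using ys(1) False by auto
    ultimately have "contains (add_leaves g v (3 - length (g ! v)))"
      using embedding_add_leaves[OF \<phi> g v ys(2)] by (auto simp: contains_def)
    moreover have "add_leaves g v (3 - length (g ! v)) \<in> set (extensions g v)"
      by (simp add: extensions_def)
    ultimately show thesis by (rule that[rotated])
  qed
qed

end

section \<open>The quadratic form of a partial graph\<close>

definition pushforward :: "(nat \<Rightarrow> 'a) \<Rightarrow> 'b :: comm_monoid_add list \<Rightarrow> 'a \<Rightarrow> 'b" where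
  "pushforward \<phi> f x = (\<Sum>i<length f. if \<phi> i = x then f ! i else 0)"

lemma sum_pushforward:
  assumes "finite S"
  shows "sum (pushforward \<phi> f) S = (\<Sum>i<length f. if \<phi> i \<in> S then f ! i else 0)"
  using assms unfolding pushforward_def by (subst sum.swap) simp

lemma pushforward_image:
  assumes "inj_on \<phi> {..<length f}" "i < length f"
  shows "pushforward \<phi> f (\<phi> i) = f ! i"
proof -
  have "pushforward \<phi> f (\<phi> i) = (\<Sum>j<length f. if j = i then f ! j else 0)"
    unfolding pushforward_def using assms
    by (intro sum.cong) (simp_all add: inj_on_eq_iff[of \<phi> "{..<length f}"])
  then show ?thesis using assms(2) by simp
qed

lemma pushforward_outside:
  assumes "x \<notin> \<phi> ` {..<length f}"
  shows "pushforward \<phi> f x = 0"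
  using assms by (auto simp: pushforward_def intro!: sum.neutral)

definition quadratic_form :: "adj_lists \<Rightarrow> int list \<Rightarrow> int" where
  "quadratic_form g f = (\<Sum>i\<leftarrow>[0..<length g]. (f ! i + (\<Sum>j\<leftarrow>g ! i. f ! j))\<^sup>2 - (f ! i)\<^sup>2)"

text \<open>
  All neighbours of a saturated vertex are known, so the value of the form at such an \<open>f\<close> does not
  depend on the rest of the graph.
\<close>

definition saturated_support :: "adj_lists \<Rightarrow> int list \<Rightarrow> bool" where
  "saturated_support g f \<longleftrightarrow> length f = length g \<and> (\<forall>i<length g. length (g ! i) = 3 \<or> f ! i = 0)"

context cubic_graph_girth_ge_5
begin

lemma sum_nbrs_pushforward:
  assumes \<phi>: "embedding \<phi> g" and g: "subcubic g" and f: "saturated_support g f"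
    and k: "k < length g"
  shows "sum (pushforward \<phi> f) (nbrs (\<phi> k)) = (\<Sum>j\<leftarrow>g ! k. f ! j)"
proof -
  have len: "length f = length g" using f by (simp add: saturated_support_def)
  have "\<phi> i \<in> nbrs (\<phi> k) \<longleftrightarrow> i \<in> set (g ! k)" if "i < length g" "f ! i \<noteq> 0" for i
    using embedding_edge[OF \<phi> k] saturated_edge[OF \<phi> g k that(1)] f that
    by (auto simp: saturated_support_def)
  then have "sum (pushforward \<phi> f) (nbrs (\<phi> k)) =
      (\<Sum>i<length g. if i \<in> set (g ! k) then f ! i else 0)"
    unfolding sum_pushforward[OF finite_nbrs] len by (intro sum.cong) auto
  also have "\<dots> = (\<Sum>i\<in>set (g ! k). f ! i)"
    using subcubicD(3)[OF g k] by (intro sum.mono_neutral_cong_right) auto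
  also have "\<dots> = (\<Sum>i\<leftarrow>g ! k. f ! i)"
    using subcubicD(2)[OF g k] by (rule sum.distinct_set_conv_list)
  finally show ?thesis .
qed

lemma sum_nbrs_pushforward_outside:
  assumes \<phi>: "embedding \<phi> g" and g: "subcubic g" and f: "saturated_support g f"
    and x: "x \<notin> \<phi> ` {..<length g}"
  shows "sum (pushforward \<phi> f) (nbrs x) = 0"
proof -
  have len: "length f = length g" using f by (simp add: saturated_support_def)
  have "f ! i = 0" if i: "i < length g" "\<phi> i \<in> nbrs x" for i
  proof (rule ccontr)
    assume "f ! i \<noteq> 0"
    then have "nbrs (\<phi> i) = \<phi> ` set (g ! i)"
      using f i(1) by (intro nbrs_saturated[OF \<phi> g]) (auto simp: saturated_support_def)
    then show False using nbrs_sym[OF i(2)] x subcubicD(3)[OF g i(1)] by auto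
  qed
  then show ?thesis unfolding sum_pushforward[OF finite_nbrs] len by (intro sum.neutral) auto
qed

lemma sum_squares_pushforward:
  assumes \<phi>: "embedding \<phi> g" and g: "subcubic g" and f: "saturated_support g f"
  defines "F \<equiv> pushforward \<phi> f"
  shows "(\<Sum>x\<in>pverts G. (F x + sum F (nbrs x))\<^sup>2 - (F x)\<^sup>2) = quadratic_form g f"
proof -
  have len: "length f = length g" using f by (simp add: saturated_support_def)
  have inj: "inj_on \<phi> {..<length g}" using \<phi> by (simp add: embedding_def)
  have "(\<Sum>x\<in>pverts G. (F x + sum F (nbrs x))\<^sup>2 - (F x)\<^sup>2) =
      (\<Sum>x\<in>\<phi> ` {..<length g}. (F x + sum F (nbrs x))\<^sup>2 - (F x)\<^sup>2)"
    using \<phi> pair_finite_verts sum_nbrs_pushforward_outside[OF \<phi> g f]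
    by (intro sum.mono_neutral_right) (auto simp: embedding_def F_def pushforward_outside len)
  also have "\<dots> = (\<Sum>i<length g. (F (\<phi> i) + sum F (nbrs (\<phi> i)))\<^sup>2 - (F (\<phi> i))\<^sup>2)"
    by (rule sum.reindex_cong[OF inj refl refl])
  also have "\<dots> = (\<Sum>i<length g. (f ! i + (\<Sum>j\<leftarrow>g ! i. f ! j))\<^sup>2 - (f ! i)\<^sup>2)"
    using inj sum_nbrs_pushforward[OF \<phi> g f] by (simp add: F_def pushforward_image len)
  also have "\<dots> = quadratic_form g f"
    by (simp add: quadratic_form_def lessThan_atLeast0 flip: sum.distinct_set_conv_list)
  finally show ?thesis .
qed

end

section \<open>Certificates\<close>

datatype certificate = Negative "int list" | Contains nat "nat list" | Branch nat "certificate list"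

definition contains_copy :: "adj_lists \<Rightarrow> adj_lists \<Rightarrow> nat list \<Rightarrow> bool" where
  "contains_copy g h p \<longleftrightarrow> length p = length h \<and> distinct p \<and>
    (\<forall>i<length h. p ! i < length g \<and> (\<forall>j\<in>set (h ! i). p ! j \<in> set (g ! (p ! i))))"

lemma (in pair_pre_digraph) contains_if_contains_copy:
  assumes p: "contains_copy g h p" and "contains g"
  shows "contains h"
proof -
  obtain \<phi> where \<phi>: "embedding \<phi> g" using assms(2) by (auto simp: contains_def)
  have "embedding (\<lambda>i. \<phi> (p ! i)) h"
    unfolding embedding_def
  proof (intro conjI allI impI ballI)
    show "inj_on (\<lambda>i. \<phi> (p ! i)) {..<length h}"
      using p embedding_eq_iff[OF \<phi>]
      by (auto simp: contains_copy_def nth_eq_iff_index_eq intro!: inj_onI)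
    show "(\<lambda>i. \<phi> (p ! i)) ` {..<length h} \<subseteq> pverts G"
      using p embedding_vertex[OF \<phi>] by (auto simp: contains_copy_def)
    show "\<phi> (p ! j) \<in> nbrs (\<phi> (p ! i))" if "i < length h" "j \<in> set (h ! i)" for i j
      using p that embedding_edge[OF \<phi>] by (auto simp: contains_copy_def)
  qed
  then show ?thesis by (auto simp: contains_def)
qed

fun check_certificate :: "adj_lists list \<Rightarrow> adj_lists \<Rightarrow> certificate \<Rightarrow> bool" where
  "check_certificate K g (Negative f) \<longleftrightarrow>
     subcubic g \<and> saturated_support g f \<and> quadratic_form g f < 0"
| "check_certificate K g (Contains i p) \<longleftrightarrow> i < length K \<and> contains_copy g (K ! i) p"
| "check_certificate K g (Branch v cs) \<longleftrightarrow>
     subcubic g \<and> v < length g \<and> list_all2 (check_certificate K) (extensions g v) cs"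

locale expanding_cubic_graph = cubic_graph_girth_ge_5 +
  assumes sum_squares_le:
    "\<And>f :: 'a \<Rightarrow> real. (\<Sum>x\<in>pverts G. (f x)\<^sup>2) \<le> (\<Sum>x\<in>pverts G. (f x + sum f (nbrs x))\<^sup>2)"
begin

lemma quadratic_form_nonneg:
  assumes "embedding \<phi> g" "subcubic g" "saturated_support g f"
  shows "0 \<le> quadratic_form g f"
proof -
  define F where "F = pushforward \<phi> f"
  have "0 \<le> real_of_int (\<Sum>x\<in>pverts G. (F x + sum F (nbrs x))\<^sup>2 - (F x)\<^sup>2)"
    using sum_squares_le[of "\<lambda>x. real_of_int (F x)"] by (simp add: sum_subtractf)
  also have "\<dots> = real_of_int (quadratic_form g f)"
    using sum_squares_pushforward[OF assms] by (simp only: F_def)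
  finally show ?thesis by simp
qed

lemma check_certificate_sound:
  assumes "check_certificate K g c" "contains g"
  shows "\<exists>h\<in>set K. contains h"
  using assms
proof (induction K g c rule: check_certificate.induct[case_names Negative Contains Branch])
  case (Negative K g f)
  then show ?case using quadratic_form_nonneg[of _ g f] by (auto simp: contains_def)
next
  case (Contains K g i p)
  then show ?case using contains_if_contains_copy[of g "K ! i" p] by auto
next
  case (Branch K g v cs)
  then obtain h where h: "h \<in> set (extensions g v)" "contains h"
    using contains_extension[of g v] by auto
  have "list_all2 (check_certificate K) (extensions g v) cs" using Branch.prems(1) by simp
  then obtain c where "c \<in> set cs" "check_certificate K h c"
    using h(1) by (metis in_set_conv_nth list_all2_conv_all_nth)
  then show ?case using Branch.IH h by blast
qed

end

section \<open>Pentagons force the Petersen graph or the dodecahedron\<close>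

definition pentagon_lists :: adj_lists where
  "pentagon_lists = [[1,4], [2,0], [3,1], [4,2], [0,3]]"

definition pentagons_common_path_lists :: adj_lists where
  "pentagons_common_path_lists =
    [[1,4,5], [0,2], [1,3,6], [2,4], [3,0], [0,6], [5,2]]"

definition pentagons_common_edge_lists :: adj_lists where
  "pentagons_common_edge_lists =
    [[1,4,7], [0,2,5], [1,3], [2,4], [3,0], [1,6], [5,7], [6,0]]"

definition pentagons_around_vertex_lists :: adj_lists where
  "pentagons_around_vertex_lists =
    [[1,2,3], [0,4,9], [0,5,6], [0,7,8], [1,5], [4,2], [2,7], [6,3], [3,9], [8,1]]"

definition petersen_lists :: adj_lists where
  "petersen_lists =
    [[1,4,5], [2,0,6], [3,1,7], [4,2,8], [0,3,9], [7,8,0], [8,9,1], [9,5,2], [5,6,3], [6,7,4]]"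

definition dodecahedral_lists :: adj_lists where
  "dodecahedral_lists =
    [[1,9,10], [2,0,11], [3,1,12], [4,2,13], [5,3,14], [6,4,15], [7,5,16], [8,6,17], [9,7,18],
    [0,8,19], [12,18,0], [13,19,1], [14,10,2], [15,11,3], [16,12,4], [17,13,5], [18,14,6],
    [19,15,7], [10,16,8], [11,17,9]]"

text \<open>The certificates were found by a computer search for short case distinctions.\<close>

definition common_path_certificate :: certificate where
  "common_path_certificate =
    Branch 3 [
     Branch 1 [
      Branch 5 [
       Branch 4 [
        Branch 6 [
         Branch 7 [
          Branch 8 [
           Contains 0 [0,1,8,9,4,5,2,7,6,3],
           Branch 9 [
            Negative [0,1,0,0,-1,0,0,1,-1,1,0], Negative [0,1,0,0,-1,0,-1,1,-1,1,0,0]]],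
          Branch 9 [
           Branch 8 [
            Negative [1,-2,0,2,0,0,0,-2,2,0,0], Negative [0,1,0,-1,0,-1,0,1,-1,1,0,0]],
           Branch 10 [
            Negative [1,-1,1,0,0,0,0,-1,0,0,1], Negative [1,-1,1,0,0,0,0,-1,0,-1,1,0]],
           Negative [2,-3,0,2,0,0,2,-3,0,-3,0,0]]],
         Branch 7 [
          Branch 8 [
           Branch 9 [
            Negative [0,0,1,0,-1,1,-1,0,0,1,0], Negative [0,0,1,0,-1,1,-1,0,-1,1,0,0]],
           Branch 10 [
            Negative [0,0,0,-1,1,0,1,0,1,0,-1], Negative [1,0,0,1,-1,0,-1,0,-1,0,1,0]],
           Negative [0,2,0,2,-3,2,-3,0,-3,0,0,0]],
          Negative [0,3,-4,-3,3,-6,5,5,0,0,0,0]]]],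
       Branch 8 [
        Branch 7 [
         Negative [2,0,1,-2,0,-2,0,2,0,0], Negative [2,-2,2,-2,0,-1,0,1,0,0,0]],
        Branch 9 [
         Negative [0,1,-2,2,0,2,0,0,0,-2], Negative [2,-2,2,-1,0,-2,0,0,0,1,0]],
        Branch 10 [
         Negative [0,1,3,-5,4,-3,0,0,-3,0,0,0], Negative [3,1,1,-3,0,-5,3,0,-3,0,0,0],
         Branch 7 [
          Negative [-1,0,0,1,0,1,0,-1,1,0,0,0], Negative [0,-2,0,2,0,1,0,-2,2,0,0,0,0]],
         Branch 9 [
          Negative [0,-1,0,1,0,1,0,0,1,-1,0,0], Negative [0,-2,0,1,0,2,0,0,2,-2,0,0,0]],
         Negative [-2,1,-2,2,0,2,0,0,1,0,-1,0,0,0]]]]]]"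

definition pentagon_certificate :: certificate where
  "pentagon_certificate =
    Branch 0 [
     Branch 5 [
      Branch 1 [
       Branch 4 [
        Branch 6 [
         Contains 0 [0,1,2,3,4,5,6], Contains 0 [0,4,3,2,1,5,6], Contains 1 [0,1,8,6,5,2,3,4],
         Contains 1 [0,4,9,6,5,3,2,1],
         Branch 7 [
          Contains 0 [0,1,2,3,4,5,7], Contains 0 [0,4,3,2,1,5,7], Contains 1 [0,1,8,7,5,2,3,4],
          Contains 1 [0,4,9,7,5,3,2,1],
          Branch 2 [
           Negative [0,2,-2,0,0,-2,2,1,0,0,0,0,0,0], Negative [0,2,-2,0,1,-2,2,0,0,0,0,0,0,0],
           Negative [0,2,-2,0,1,-2,0,2,0,0,0,0,0,0], Negative [0,2,-2,0,1,-2,0,2,0,0,0,0,0,0],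
           Branch 3 [
            Negative [0,0,1,-2,2,-2,2,0,0,0,0,0,0,0,0],
            Negative [0,1,0,-2,2,-2,2,0,0,0,0,0,0,0,0],
            Negative [0,0,0,-2,2,-2,1,2,0,0,0,0,0,0,0],
            Negative [0,1,0,-2,2,-2,0,2,0,0,0,0,0,0,0],
            Negative [3,-4,2,2,-4,4,-3,-3,0,0,0,0,0,0,0,0]]]]]]]]]"

definition common_edge_certificate :: certificate where
  "common_edge_certificate =
    Branch 2 [
     Branch 5 [
      Branch 8 [
       Contains 0 [1,5,6,8,2,0,7], Contains 0 [0,1,2,8,7,4,3], Contains 1 [1,0,2,5,4,3,8,9,6,7],
       Branch 6 [
        Contains 0 [0,4,3,2,1,7,6], Negative [1,0,-2,0,0,2,-2,0,2,0,0,0],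
        Negative [1,0,-2,0,0,2,-2,0,2,0,0,0],
        Branch 10 [
         Contains 0 [2,3,4,0,1,8,10], Negative [2,0,-2,0,0,0,1,-2,2,0,0,0,0],
         Branch 9 [
          Contains 0 [1,2,3,9,5,0,4], Contains 0 [0,1,5,6,7,4,9],
          Negative [0,0,2,0,0,-2,1,0,-2,2,0,0,0,0]],
         Branch 10 [
          Contains 0 [2,3,4,0,1,8,10], Negative [1,-2,0,0,0,2,0,0,2,0,-2,0,0],
          Branch 12 [
           Negative [0,-2,0,2,0,2,0,0,1,0,0,0,-2,0], Contains 0 [0,7,6,12,4,1,5],
           Branch 3 [
            Contains 0 [1,2,3,9,5,0,4],
            Branch 7 [
             Negative [0,1,0,0,0,0,-2,2,-2,0,2,0,0,0,0], Contains 0 [0,4,3,2,1,7,13],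
             Branch 13 [
              Negative [0,0,0,1,0,2,-2,0,0,0,2,0,0,-2,0,0],
              Negative [-2,0,0,2,0,0,0,2,0,0,1,0,0,-2,0,0],
              Negative [2,-2,0,0,0,0,2,-2,2,0,-2,0,0,1,0,0,0]]],
            Negative [0,0,-1,1,0,1,0,0,0,0,1,0,-1,0,0],
            Negative [0,0,-8,5,0,6,-3,0,1,0,6,0,-4,0,0,0]]]],
         Branch 11 [
          Contains 0 [2,3,4,0,1,8,11], Negative [2,0,-2,0,0,1,0,-2,2,0,0,0,0,0,0],
          Branch 11 [
           Contains 0 [2,3,4,0,1,8,11], Contains 0 [5,6,7,0,1,9,11],
           Negative [1,-2,0,0,0,2,0,0,2,0,0,-2,0,0,0],
           Negative [0,2,0,0,0,-2,0,0,-2,0,1,2,0,0,0,0]],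
          Branch 12 [
           Negative [0,2,-2,0,0,0,-2,0,0,0,1,0,2,0,0], Contains 0 [0,7,6,12,4,1,5],
           Branch 13 [
            Contains 0 [8,10,13,3,2,11,12], Negative [-2,0,0,0,2,0,2,0,1,0,0,0,-2,0,0],
            Branch 3 [
             Contains 0 [1,2,3,9,5,0,4], Negative [-4,8,7,-4,0,-9,3,0,-10,0,5,0,3,0,0],
             Negative [0,0,-5,3,0,4,-2,0,1,0,3,0,1,-4,0,0]],
            Negative [1,-2,0,0,0,2,0,0,2,0,-2,0,-2,2,0,0]],
           Branch 14 [
            Contains 0 [8,10,14,3,2,11,12], Negative [-2,0,0,0,2,0,2,0,1,0,0,0,-2,0,0],
            Branch 3 [
             Contains 0 [1,2,3,9,5,0,4], Negative [-3,6,5,-3,0,-7,3,0,-7,0,3,0,1,0,1],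
             Negative [0,1,-6,3,0,4,-3,0,1,0,4,0,2,0,-5,0]],
            Negative [1,-2,0,0,0,2,0,0,2,0,-2,0,-2,0,2,0]],
           Negative [1,-3,0,0,0,2,0,0,3,0,-2,0,-2,0,0,0]],
          Negative [-2,4,0,0,0,-3,1,0,-4,0,2,2,0,0,0,0,0]]]]]]]"

definition around_vertex_certificate :: certificate where
  "around_vertex_certificate =
    Branch 4 [
     Contains 0 [0,1,4,5,2,3,7],
     Branch 9 [
      Contains 0 [0,1,9,8,3,2,6],
      Branch 6 [
       Contains 0 [2,5,4,1,0,6,10],
       Branch 7 [
        Negative [0,-2,0,2,2,0,1,-2,0,0,0,0], Negative [0,-2,2,0,0,0,-2,1,0,2,0,0,0]],
       Branch 11 [
        Contains 0 [1,4,5,2,0,9,11], Contains 0 [3,8,9,1,0,7,11],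
        Branch 5 [
         Contains 0 [0,2,5,8,3,1,4],
         Branch 7 [
          Negative [0,1,-2,0,0,2,0,2,0,0,-2,0,0,0], Contains 0 [3,8,9,1,0,7,11],
          Contains 0 [2,6,7,3,0,5,13],
          Branch 12 [
           Contains 0 [3,7,6,2,0,8,12], Negative [0,0,2,0,-2,0,-2,1,0,0,2,0,0,0,0],
           Negative [3,0,0,-4,-6,5,-7,6,0,0,0,4,0,0,0],
           Branch 12 [
            Contains 0 [3,7,6,2,0,8,12], Contains 0 [5,13,12,10,4,2,6],
            Negative [0,0,0,0,-2,2,0,1,0,0,0,2,-2,0,0],
            Branch 13 [
             Negative [0,0,0,2,0,1,-2,0,-2,0,0,0,2,0,0,0], Contains 0 [4,10,11,9,1,5,13],
             Contains 0 [6,12,13,5,2,7,14],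
             Branch 10 [
              Negative [0,0,0,5,0,-3,4,-8,0,-3,5,0,1,0,0,0,0],
              Negative [0,0,0,0,-2,0,0,1,0,0,2,0,-2,2,0,0,0],
              Branch 14 [
               Negative [0,0,0,2,0,0,0,-2,0,-2,0,2,1,0,0,0,0],
               Branch 8 [
                Contains 0 [7,14,15,8,3,6,12], Contains 0 [9,11,10,16,8,1,4],
                Branch 14 [
                 Negative [0,0,0,2,0,0,1,-2,0,-2,0,2,0,0,0,0,0,0],
                 Contains 0 [12,15,14,16,13,6,7],
                 Branch 11 [
                  Negative [0,0,0,0,0,0,1,0,0,0,-2,2,-2,2,0,0,0,0],
                  Branch 17 [
                   Negative [0,1,0,0,0,0,0,0,-2,0,-2,2,0,0,0,0,0,2,0],
                   Branch 15 [
                    Branch 16 [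
                     Branch 18 [
                      Contains 1 [0,1,9,11,18,19,15,12,6,2,3,4,8,10,17,16,14,13,7,5],
                      Negative [-2,0,0,2,0,2,0,0,0,0,0,0,0,-2,-2,2,0,0,1,0,0]],
                     Negative [-2,0,2,0,0,0,0,0,0,2,0,-2,0,-2,0,1,2,0,0,0,0]]],
                   Negative [0,2,-2,0,0,0,2,0,0,-2,0,1,0,0,-2,0,0,2,0,0]]],
                 Negative [0,0,0,0,2,-2,2,-2,2,-2,0,0,0,0,1,0,0,0,0]]],
               Negative [0,0,0,1,0,0,2,-2,0,0,0,0,0,-2,0,0,2],
               Negative [0,-2,0,2,2,0,0,-2,0,0,0,0,2,-2,1,0,0,0,0]],
              Negative [0,2,0,-2,-2,0,0,2,0,0,1,0,-2,2,0,0,0,0]]]],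
           Branch 8 [
            Negative [0,0,-2,2,0,2,0,0,-2,0,0,0,1,0,0,0,0],
            Negative [0,0,0,2,0,0,-2,0,-2,1,0,0,2,0,0,0,0],
            Negative [0,0,0,2,0,0,-2,0,-2,1,0,0,2,0,0,0,0],
            Negative [0,0,0,1,-2,2,-2,1,-2,2,0,0,1,0,0,0,0,0]]]]],
        Branch 11 [
         Contains 0 [1,4,5,2,0,9,11],
         Branch 5 [
          Contains 0 [0,2,5,8,3,1,4],
          Branch 7 [
           Negative [0,2,0,-2,-2,1,0,2,0,0,0,0,0,0], Contains 0 [2,6,7,3,0,5,13],
           Negative [3,0,0,-4,-6,5,-7,6,0,0,0,4,0,0,0]]],
         Branch 13 [
          Negative [0,0,0,1,2,-2,0,0,0,-2,0,2,0,0], Negative [0,0,0,2,1,0,0,-2,0,-2,0,2,0,0],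
          Branch 12 [
           Branch 13 [
            Negative [0,-1,0,1,1,0,0,0,0,0,0,1,0,-1,0],
            Negative [0,2,0,0,-2,0,1,0,0,0,0,-2,0,2,0,0]]],
          Negative [2,-3,0,0,1,0,-2,0,0,0,0,3,0,-2,0,0]]],
        Branch 5 [
         Contains 0 [0,2,5,8,3,1,4], Negative [1,0,0,0,2,-2,0,0,0,-2,0,2,0,0,0],
         Negative [0,0,1,0,2,-2,0,0,0,-2,0,2,0,0,0],
         Branch 7 [
          Negative [0,1,0,0,-2,2,-2,2,0,0,0,0,0,0,0,0],
          Negative [0,0,0,2,0,0,1,-2,0,-2,0,2,0,0,0,0],
          Negative [0,0,0,2,1,0,0,-2,0,-2,0,2,0,0,0,0], Contains 0 [2,6,7,3,0,5,15],
          Negative [0,2,0,-5,-6,5,-4,6,0,5,0,-4,0,0,0,0,0]]]]]]]"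

context expanding_cubic_graph
begin

lemma contains_petersen_if_pentagons_common_path:
  assumes "contains pentagons_common_path_lists"
  shows "contains petersen_lists"
proof -
  have "check_certificate [petersen_lists] pentagons_common_path_lists common_path_certificate"
    by code_simp
  from check_certificate_sound[OF this assms] show ?thesis by simp
qed

lemma contains_pentagons_common_edge:
  assumes "contains pentagon_lists"
  shows "contains pentagons_common_path_lists \<or> contains pentagons_common_edge_lists"
proof -
  have "check_certificate [pentagons_common_path_lists, pentagons_common_edge_lists]
      pentagon_lists pentagon_certificate"
    by code_simp
  from check_certificate_sound[OF this assms] show ?thesis by simp
qed

lemma contains_pentagons_around_vertex:
  assumes "contains pentagons_common_edge_lists"
  shows "contains pentagons_common_path_lists \<or> contains pentagons_around_vertex_lists"
proof -
  have "check_certificate [pentagons_common_path_lists, pentagons_around_vertex_lists]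
      pentagons_common_edge_lists common_edge_certificate"
    by code_simp
  from check_certificate_sound[OF this assms] show ?thesis by simp
qed

lemma contains_dodecahedron:
  assumes "contains pentagons_around_vertex_lists"
  shows "contains pentagons_common_path_lists \<or> contains dodecahedral_lists"
proof -
  have "check_certificate [pentagons_common_path_lists, dodecahedral_lists]
      pentagons_around_vertex_lists around_vertex_certificate"
    by code_simp
  from check_certificate_sound[OF this assms] show ?thesis by simp
qed

lemma contains_petersen_or_dodecahedron:
  assumes "contains pentagon_lists"
  shows "contains petersen_lists \<or> contains dodecahedral_lists"
  using assms contains_petersen_if_pentagons_common_path contains_pentagons_common_edge
    contains_pentagons_around_vertex contains_dodecahedron
  by blast

end

section \<open>Recognising the two graphs\<close>

definition digraph_of :: "adj_lists \<Rightarrow> nat pair_pre_digraph" where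
  "digraph_of g = \<lparr>pverts = {..<length g}, parcs = {(i, j). i < length g \<and> j \<in> set (g ! i)}\<rparr>"

lemma pair_wf_digraph_digraph_of: "subcubic g \<Longrightarrow> pair_wf_digraph (digraph_of g)"
  by unfold_locales (auto simp: digraph_of_def dest: subcubicD(3))

lemma (in cubic_graph_girth_ge_5) digraph_iso_if_contains:
  assumes conn: "Digraph_Component.connected (with_proj G)" and "contains g"
    and g: "subcubic g" "g \<noteq> []" "\<forall>i<length g. length (g ! i) = 3"
  shows "digraph_iso (with_proj G) (with_proj (digraph_of g))"
proof -
  obtain \<phi> where \<phi>: "embedding \<phi> g" using assms(2) by (auto simp: contains_def)
  let ?S = "\<phi> ` {..<length g}"
  have nbrs: "nbrs (\<phi> i) = \<phi> ` set (g ! i)" if "i < length g" for i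
    using that g(3) by (intro nbrs_saturated[OF \<phi> g(1)]) simp_all
  have "?S = pverts G"
  proof (rule connected_closed_set[OF conn])
    show "?S \<subseteq> pverts G" "?S \<noteq> {}" using \<phi> g(2) by (auto simp: embedding_def)
    show "y \<in> ?S" if "x \<in> ?S" "(x, y) \<in> parcs G" for x y
      using that nbrs subcubicD(3)[OF g(1)] by (fastforce simp: nbrs_def)
  qed
  then have "bij_betw \<phi> (pverts (digraph_of g)) (pverts G)"
    using \<phi> by (simp add: bij_betw_def embedding_def digraph_of_def)
  moreover have "(\<phi> i, \<phi> j) \<in> parcs G \<longleftrightarrow> (i, j) \<in> parcs (digraph_of g)"
    if "i \<in> pverts (digraph_of g)" "j \<in> pverts (digraph_of g)" for i j
  proof -
    have ij: "i < length g" "j < length g" using that by (simp_all add: digraph_of_def)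
    have "(\<phi> i, \<phi> j) \<in> parcs G \<longleftrightarrow> \<phi> j \<in> \<phi> ` set (g ! i)"
      using nbrs[OF ij(1)] by (auto simp: nbrs_def)
    also have "\<dots> \<longleftrightarrow> j \<in> set (g ! i)"
      using embedding_eq_iff[OF \<phi> ij(2)] subcubicD(3)[OF g(1) ij(1)] by auto
    finally show ?thesis using ij by (simp add: digraph_of_def)
  qed
  ultimately have iso: "digraph_iso (with_proj (digraph_of g)) (with_proj G)"
    using pair_wf_digraph_digraph_of[OF g(1)] pair_wf_digraph by (intro digraph_iso_with_projI)
  have "wf_digraph (with_proj (digraph_of g))"
    using pair_wf_digraph_digraph_of[OF g(1)] by (simp add: wf_digraph_wp_iff)
  then show ?thesis using iso by (rule digraph_iso_swap)
qed

lemma digraph_iso_digraph_of: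
  assumes g: "subcubic g" and H: "pair_wf_digraph H"
    and us: "distinct us" "set us = pverts H" "length us = length g"
    and adj: "\<forall>i<length g. \<forall>j<length g. (us ! i, us ! j) \<in> parcs H \<longleftrightarrow> j \<in> set (g ! i)"
  shows "digraph_iso (with_proj (digraph_of g)) (with_proj H)"
proof (rule digraph_iso_with_projI)
  show "bij_betw ((!) us) (pverts (digraph_of g)) (pverts H)"
    using us by (intro bij_betw_nth) (simp_all add: digraph_of_def)
  show "(us ! i, us ! j) \<in> parcs H \<longleftrightarrow> (i, j) \<in> parcs (digraph_of g)"
    if "i \<in> pverts (digraph_of g)" "j \<in> pverts (digraph_of g)" for i j
    using that adj by (simp add: digraph_of_def)
qed (use g H pair_wf_digraph_digraph_of in auto)

definition petersen_vertices :: "nat set list" where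
  "petersen_vertices =
    [{0,1}, {2,3}, {0,4}, {1,2}, {3,4}, {2,4}, {1,4}, {1,3}, {0,3}, {0,2}]"

lemma set_petersen_vertices: "set petersen_vertices = pverts petersen_graph"
proof (rule card_subset_eq)
  show "finite (pverts petersen_graph)" by (simp add: petersen_graph_def)
  show "set petersen_vertices \<subseteq> pverts petersen_graph"
    by (auto simp: petersen_vertices_def petersen_graph_def)
  have "distinct petersen_vertices" by code_simp
  then have "card (set petersen_vertices) = 10"
    by (simp add: distinct_card) (simp add: petersen_vertices_def)
  then show "card (set petersen_vertices) = card (pverts petersen_graph)"
    using n_subsets[of "{..<5::nat}" 2] by (simp add: petersen_graph_def choose_two)
qed

lemma digraph_iso_petersen:
  "digraph_iso (with_proj (digraph_of petersen_lists)) (with_proj petersen_graph)"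
proof (rule digraph_iso_digraph_of[of _ _ petersen_vertices])
  have "\<forall>i<length petersen_lists. \<forall>j<length petersen_lists.
      petersen_vertices ! i \<inter> petersen_vertices ! j = {} \<longleftrightarrow> j \<in> set (petersen_lists ! i)"
    by code_simp
  moreover have "petersen_vertices ! i \<in> pverts petersen_graph" if "i < length petersen_lists" for i
    using that nth_mem[of i petersen_vertices] unfolding set_petersen_vertices
    by (simp add: petersen_vertices_def petersen_lists_def)
  ultimately show "\<forall>i<length petersen_lists. \<forall>j<length petersen_lists.
      (petersen_vertices ! i, petersen_vertices ! j) \<in> parcs petersen_graph \<longleftrightarrow>
        j \<in> set (petersen_lists ! i)"
    by (simp add: petersen_graph_def)
  show "pair_wf_digraph petersen_graph" by unfold_locales (auto simp: petersen_graph_def)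
  show "subcubic petersen_lists" "distinct petersen_vertices"
    "length petersen_vertices = length petersen_lists"
    by code_simp+
qed (rule set_petersen_vertices)

definition dodecahedral_vertices :: "(bool \<times> nat) list" where
  "dodecahedral_vertices = List.product [False, True] [0..<10]"

lemma set_dodecahedral_vertices: "set dodecahedral_vertices = pverts dodecahedral_graph"
  by (auto simp: dodecahedral_vertices_def dodecahedral_graph_def generalized_petersen_def Let_def)

lemma parcs_dodecahedral_graph_iff:
  assumes "u \<in> pverts dodecahedral_graph" "v \<in> pverts dodecahedral_graph"
  shows "(u, v) \<in> parcs dodecahedral_graph \<longleftrightarrow> dodecahedral_adj u v"
proof -
  obtain b i c j where uv: "u = (b, i)" "v = (c, j)" by (metis surj_pair)
  then have "i < 10" "j < 10"
    using assms by (auto simp: dodecahedral_graph_def generalized_petersen_def Let_def)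
  then show ?thesis
    by (cases b; cases c)
      (auto simp: uv dodecahedral_graph_def generalized_petersen_def Let_def dodecahedral_adj_def)
qed

lemma digraph_iso_dodecahedron:
  "digraph_iso (with_proj (digraph_of dodecahedral_lists)) (with_proj dodecahedral_graph)"
proof (rule digraph_iso_digraph_of[of _ _ dodecahedral_vertices])
  have "\<forall>i<length dodecahedral_lists. \<forall>j<length dodecahedral_lists.
      dodecahedral_adj (dodecahedral_vertices ! i) (dodecahedral_vertices ! j) \<longleftrightarrow>
        j \<in> set (dodecahedral_lists ! i)"
    by code_simp
  moreover have "dodecahedral_vertices ! i \<in> pverts dodecahedral_graph"
    if "i < length dodecahedral_lists" for i
    using that nth_mem[of i dodecahedral_vertices] unfolding set_dodecahedral_vertices
    by (simp add: dodecahedral_vertices_def dodecahedral_lists_def)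
  ultimately show "\<forall>i<length dodecahedral_lists. \<forall>j<length dodecahedral_lists.
      (dodecahedral_vertices ! i, dodecahedral_vertices ! j) \<in> parcs dodecahedral_graph \<longleftrightarrow>
        j \<in> set (dodecahedral_lists ! i)"
    by (simp add: parcs_dodecahedral_graph_iff)
  show "pair_wf_digraph dodecahedral_graph"
    by unfold_locales (auto simp: dodecahedral_graph_def generalized_petersen_def Let_def)
  show "subcubic dodecahedral_lists" "distinct dodecahedral_vertices"
    "length dodecahedral_vertices = length dodecahedral_lists"
    by code_simp+
qed (rule set_dodecahedral_vertices)

section \<open>The classification\<close>

lemma (in pair_sym_digraph) contains_pentagon:
  assumes "girth G = 5"
  shows "contains pentagon_lists"
proof -
  obtain p where "cycle p" "length p = 5"
    using girth_attained[of G 5] assms by (auto simp: numeral_eq_enat)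
  then obtain a b c d e where distinct: "distinct [a, b, c, d, e]"
    and arcs: "(a, b) \<in> parcs G" "(b, c) \<in> parcs G" "(c, d) \<in> parcs G" "(d, e) \<in> parcs G"
      "(e, a) \<in> parcs G"
    by (rule cycle_length_five)
  have "embedding ((!) [a, b, c, d, e]) pentagon_lists"
    unfolding embedding_def
  proof (intro conjI)
    show "inj_on ((!) [a, b, c, d, e]) {..<length pentagon_lists}"
      using distinct by (intro inj_on_nth) (auto simp: pentagon_lists_def)
    show "(!) [a, b, c, d, e] ` {..<length pentagon_lists} \<subseteq> pverts G"
      using arcs in_arcsD1 by (auto simp: pentagon_lists_def lessThan_Suc eval_nat_numeral)
    show "\<forall>i<length pentagon_lists. \<forall>j\<in>set (pentagon_lists ! i).
        [a, b, c, d, e] ! j \<in> nbrs ([a, b, c, d, e] ! i)"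
      using arcs arcs[THEN arcs_symmetric]
      by (simp add: pentagon_lists_def nbrs_def All_less_Suc eval_nat_numeral)
  qed
  then show ?thesis by (auto simp: contains_def)
qed

lemma expanding_cubic_graph_if_no_eigenvalue:
  assumes "pair_graph G" and cubic: "\<forall>x\<in>pverts G. out_degree (with_proj G) x = 3" and "5 \<le> girth G"
    and vs: "distinct vs" "set vs = pverts G"
    and gap: "\<And>k. eigenvalue (adjacency_matrix G vs) k \<Longrightarrow> k \<notin> {-2<..<0}"
  shows "expanding_cubic_graph G"
proof -
  interpret pair_graph G by fact
  have sym: "sym (parcs G)" using arcs_symmetric by (auto intro: symI)
  have "{y. y \<in> set vs \<and> (x, y) \<in> parcs G} = nbrs x" for x
    using nbrs_subset by (auto simp: nbrs_def vs(2))
  then have "(\<Sum>x\<in>pverts G. (f x)\<^sup>2) \<le> (\<Sum>x\<in>pverts G. (f x + sum f (nbrs x))\<^sup>2)" for f :: "'a \<Rightarrow> real"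
    using sum_squares_le_if_no_eigenvalue[OF vs(1) sym gap, of f] by (simp add: vs(2))
  then show ?thesis using cubic \<open>5 \<le> girth G\<close> by unfold_locales simp_all
qed

theorem theorem5p1:
  fixes G :: "'a pair_pre_digraph" and vs :: "'a list"
  assumes "pair_graph G"
    and "Digraph_Component.connected (with_proj G)"
    and "\<forall>v \<in> pverts G. out_degree (with_proj G) v = 3"
    and "girth G = 5"
    and "distinct vs" and "set vs = pverts G"
    and "\<forall>x. eigenvalue (adjacency_matrix G vs) x \<longrightarrow> x \<notin> {-2<..<0}"
  shows "digraph_iso (with_proj G) (with_proj petersen_graph) \<or>
         digraph_iso (with_proj G) (with_proj dodecahedral_graph)"
proof -
  interpret expanding_cubic_graph G
    using assms by (intro expanding_cubic_graph_if_no_eigenvalue[of G vs]) auto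
  have "contains petersen_lists \<or> contains dodecahedral_lists"
    using contains_pentagon[OF \<open>girth G = 5\<close>] by (rule contains_petersen_or_dodecahedron)
  then show ?thesis
  proof
    assume "contains petersen_lists"
    then have "digraph_iso (with_proj G) (with_proj (digraph_of petersen_lists))"
      by (rule digraph_iso_if_contains[OF assms(2)]) code_simp+
    also note digraph_iso_petersen
    finally show ?thesis ..
  next
    assume "contains dodecahedral_lists"
    then have "digraph_iso (with_proj G) (with_proj (digraph_of dodecahedral_lists))"
      by (rule digraph_iso_if_contains[OF assms(2)]) code_simp+
    also note digraph_iso_dodecahedron
    finally show ?thesis ..
  qed
qed

end
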